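(* Let $n\ge2$, let $\varphi\colon B_n\to G_n$ be a representation (homomorphism) of the braid group $B_n$ into a group $G_n$, let $\Bbbk$ be a field, and let $a,b,c\in\Bbbk$. Then the map $\Phi_{a,b,c}\colon SM_n\to\Bbbk[G_n]$ which acts on the generators by $$\Phi_{a,b,c}(\sigma_i^{\pm1})=\varphi(\sigma_i^{\pm1}),\qquad \Phi_{a,b,c}(\tau_i)=a\,\varphi(\sigma_i)+b\,\varphi(\sigma_i^{-1})+c\,e,\qquad i=1,\dots,n-1,$$ where $e$ is the unit element of $G_n$, defines a representation of $SM_n$ into $\Bbbk[G_n]$, i.e. a monoid homomorphism from $SM_n$ to the multiplicative monoid of the group algebra $\Bbbk[G_n]$.
   Context: The braid group $B_n$ is generated by $\sigma_1,\dots,\sigma_{n-1}$ with relations $\sigma_i\sigma_{i+1}\sigma_i=\sigma_{i+1}\sigma_i\sigma_{i+1}$ for $1\le i\le n-2$, and $\sigma_i\sigma_j=\sigma_j\sigma_i$ for $|i-j|\ge2$. The singular braid monoid $SM_n$ is the monoid generated by $\sigma_i^{\pm1},\tau_i$ ($1\le i\le n-1$), where the $\sigma_i^{\pm1}$ satisfy the relations of $B_n$ (including $\sigma_i\sigma_i^{-1}=\sigma_i^{-1}\sigma_i=1$), together with the relations: $\tau_i\tau_j=\tau_j\tau_i$ and $\tau_i\sigma_j=\sigma_j\tau_i$ for $|i-j|\ge2$; $\tau_i\sigma_i=\sigma_i\tau_i$ for all $i$; $\sigma_i\sigma_{i+1}\tau_i=\tau_{i+1}\sigma_i\sigma_{i+1}$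 and $\sigma_{i+1}\sigma_i\tau_{i+1}=\tau_i\sigma_{i+1}\sigma_i$ for $1\le i\le n-2$. *)

theory Defs
  imports "HOL-Algebra.Module"
begin

section \<open>Monoids given by generators and relations\<close>

text \<open>The least congruence on the free monoid of words over \<open>A\<close> that contains the
  relations \<open>R\<close>.\<close>

inductive word_cong :: "'a set \<Rightarrow> ('a list \<times> 'a list) set \<Rightarrow> 'a list \<Rightarrow> 'a list \<Rightarrow> bool"
  for A R where
  rel: "\<lbrakk>(u, v) \<in> R; u \<in> lists A; v \<in> lists A; p \<in> lists A; q \<in> lists A\<rbrakk>
    \<Longrightarrow> word_cong A R (p @ u @ q) (p @ v @ q)"
| refl: "w \<in> lists A \<Longrightarrow> word_cong A R w w"
| sym: "word_cong A R u v \<Longrightarrow> word_cong A R v u"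
| trans: "word_cong A R u v \<Longrightarrow> word_cong A R v w \<Longrightarrow> word_cong A R u w"

definition word_class :: "'a set \<Rightarrow> ('a list \<times> 'a list) set \<Rightarrow> 'a list \<Rightarrow> 'a list set" where
  "word_class A R w = {v. word_cong A R w v}"

definition presented_monoid :: "'a set \<Rightarrow> ('a list \<times> 'a list) set \<Rightarrow> 'a list set monoid" where
  "presented_monoid A R =
    \<lparr>carrier = word_class A R ` lists A,
     mult = (\<lambda>X Y. \<Union>u\<in>X. \<Union>v\<in>Y. word_class A R (u @ v)),
     one = word_class A R []\<rparr>"

lemma word_cong_in_lists:
  "word_cong A R u v \<Longrightarrow> u \<in> lists A \<and> v \<in> lists A"
  by (induction rule: word_cong.induct) auto

lemma word_cong_context:
  assumes "word_cong A R u v" "p \<in> lists A" "q \<in> lists A"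
  shows "word_cong A R (p @ u @ q) (p @ v @ q)"
  using assms(1)
proof (induction rule: word_cong.induct)
  case (rel u v p' q')
  then show ?case
    using word_cong.rel[of u v R A "p @ p'" "q' @ q"] assms(2,3) by simp
next
  case (refl w)
  then show ?case using assms(2,3) by (intro word_cong.refl) auto
qed (use word_cong.sym word_cong.trans in blast)+

lemma word_cong_append:
  assumes "word_cong A R u u'" "word_cong A R v v'"
  shows "word_cong A R (u @ v) (u' @ v')"
proof (rule word_cong.trans)
  show "word_cong A R (u @ v) (u' @ v)"
    using word_cong_context[OF assms(1), of "[]" v] word_cong_in_lists[OF assms(2)] by simp
  show "word_cong A R (u' @ v) (u' @ v')"
    using word_cong_context[OF assms(2), of u' "[]"] word_cong_in_lists[OF assms(1)] by simp
qed

lemma word_class_eq_iff: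
  assumes "u \<in> lists A"
  shows "word_class A R u = word_class A R v \<longleftrightarrow> word_cong A R u v"
proof
  assume "word_class A R u = word_class A R v"
  then show "word_cong A R u v"
    using word_cong.refl[OF assms] word_cong.sym by (force simp: word_class_def)
next
  assume "word_cong A R u v"
  then show "word_class A R u = word_class A R v"
    unfolding word_class_def by (blast intro: word_cong.sym word_cong.trans)
qed

lemma presented_monoid_mult:
  assumes "u \<in> lists A" "v \<in> lists A"
  shows "word_class A R u \<otimes>\<^bsub>presented_monoid A R\<^esub> word_class A R v = word_class A R (u @ v)"
proof -
  have eq: "word_class A R (u' @ v') = word_class A R (u @ v)"
    if "u' \<in> word_class A R u" "v' \<in> word_class A R v" for u' v'
  proof -
    have "word_cong A R (u @ v) (u' @ v')"
      using that word_cong_append by (simp add: word_class_def)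
    then show ?thesis
      using word_class_eq_iff assms by (metis append_in_lists_conv)
  qed
  have "u \<in> word_class A R u" "v \<in> word_class A R v"
    using assms by (simp_all add: word_class_def word_cong.refl)
  then have "(\<Union>u'\<in>word_class A R u. \<Union>v'\<in>word_class A R v. word_class A R (u' @ v'))
      = word_class A R (u @ v)"
    using eq by blast
  then show ?thesis by (simp add: presented_monoid_def)
qed

lemma presented_monoid_carrier:
  "carrier (presented_monoid A R) = word_class A R ` lists A"
  by (simp add: presented_monoid_def)

lemma presented_monoid_one:
  "\<one>\<^bsub>presented_monoid A R\<^esub> = word_class A R []"
  by (simp add: presented_monoid_def)

lemma monoid_presented_monoid: "monoid (presented_monoid A R)"
  by (rule monoidI; unfold presented_monoid_carrier presented_monoid_one; (elim imageE)?)
    (simp_all add: presented_monoid_mult)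


section \<open>The braid group and the singular braid monoid\<close>

datatype letter = Sigma nat | SigmaInv nat | Tau nat

definition braid_letters :: "nat \<Rightarrow> letter set" where
  "braid_letters n = Sigma ` {1..<n} \<union> SigmaInv ` {1..<n}"

text \<open>The inverses of the generators are letters of the alphabet, so the first two
  families of relations turn the monoid presentation into the group presentation.\<close>

definition braid_rels :: "nat \<Rightarrow> (letter list \<times> letter list) set" where
  "braid_rels n =
    {([Sigma i, SigmaInv i], []) |i. i \<in> {1..<n}} \<union>
    {([SigmaInv i, Sigma i], []) |i. i \<in> {1..<n}} \<union>
    {([Sigma i, Sigma (i + 1), Sigma i], [Sigma (i + 1), Sigma i, Sigma (i + 1)]) |i.
       1 \<le> i \<and> i + 2 \<le> n} \<union>
    {([Sigma i, Sigma j], [Sigma j, Sigma i]) |i j.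
       i \<in> {1..<n} \<and> j \<in> {1..<n} \<and> \<bar>int i - int j\<bar> \<ge> 2}"

abbreviation braid_class :: "nat \<Rightarrow> letter list \<Rightarrow> letter list set" where
  "braid_class n \<equiv> word_class (braid_letters n) (braid_rels n)"

definition braid_group :: "nat \<Rightarrow> letter list set monoid" where
  "braid_group n = presented_monoid (braid_letters n) (braid_rels n)"

definition sbraid_letters :: "nat \<Rightarrow> letter set" where
  "sbraid_letters n = braid_letters n \<union> Tau ` {1..<n}"

definition sbraid_rels :: "nat \<Rightarrow> (letter list \<times> letter list) set" where
  "sbraid_rels n = braid_rels n \<union>
    {([Tau i, Tau j], [Tau j, Tau i]) |i j.
       i \<in> {1..<n} \<and> j \<in> {1..<n} \<and> \<bar>int i - int j\<bar> \<ge> 2} \<union>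
    {([Tau i, Sigma j], [Sigma j, Tau i]) |i j.
       i \<in> {1..<n} \<and> j \<in> {1..<n} \<and> \<bar>int i - int j\<bar> \<ge> 2} \<union>
    {([Tau i, Sigma i], [Sigma i, Tau i]) |i. i \<in> {1..<n}} \<union>
    {([Sigma i, Sigma (i + 1), Tau i], [Tau (i + 1), Sigma i, Sigma (i + 1)]) |i.
       1 \<le> i \<and> i + 2 \<le> n} \<union>
    {([Sigma (i + 1), Sigma i, Tau (i + 1)], [Tau i, Sigma (i + 1), Sigma i]) |i.
       1 \<le> i \<and> i + 2 \<le> n}"

abbreviation sbraid_class :: "nat \<Rightarrow> letter list \<Rightarrow> letter list set" where
  "sbraid_class n \<equiv> word_class (sbraid_letters n) (sbraid_rels n)"

definition singular_braid_monoid :: "nat \<Rightarrow> letter list set monoid" where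
  "singular_braid_monoid n = presented_monoid (sbraid_letters n) (sbraid_rels n)"

lemma monoid_singular_braid_monoid: "monoid (singular_braid_monoid n)"
  by (simp add: singular_braid_monoid_def monoid_presented_monoid)

lemma group_braid_group: "group (braid_group n)"
proof -
  let ?A = "braid_letters n" and ?R = "braid_rels n"
  interpret monoid "presented_monoid ?A ?R" by (rule monoid_presented_monoid)
  have inverse: "\<exists>v\<in>lists ?A. word_cong ?A ?R (v @ w) []" if "w \<in> lists ?A" for w
    using that
  proof (induction w rule: lists.induct)
    case Nil
    then show ?case using word_cong.refl[of "[]" ?A ?R] by (intro bexI[of _ "[]"]) simp_all
  next
    case (Cons x w)
    then obtain v where v: "v \<in> lists ?A" "word_cong ?A ?R (v @ w) []" by blast
    have "\<exists>y\<in>?A. ([y, x], []) \<in> ?R"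
      using Cons.hyps by (fastforce simp: braid_letters_def braid_rels_def)
    then obtain y where y: "y \<in> ?A" "([y, x], []) \<in> ?R" by blast
    have "word_cong ?A ?R (v @ [y, x] @ w) (v @ [] @ w)"
      using y v Cons.hyps by (intro word_cong.rel) simp_all
    then have "word_cong ?A ?R ((v @ [y]) @ x # w) []"
      using v(2) word_cong.trans by fastforce
    with v y show ?case
      by (intro bexI[of _ "v @ [y]"]) simp_all
  qed
  show ?thesis
    unfolding braid_group_def
  proof (rule groupI)
    fix X assume "X \<in> carrier (presented_monoid ?A ?R)"
    then obtain w where w: "w \<in> lists ?A" "X = word_class ?A ?R w"
      unfolding presented_monoid_carrier by blast
    with inverse obtain v where "v \<in> lists ?A" "word_cong ?A ?R (v @ w) []" by blast
    moreover from this(1) have "word_class ?A ?R v \<in> carrier (presented_monoid ?A ?R)"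
      unfolding presented_monoid_carrier by (rule imageI)
    ultimately show "\<exists>Y\<in>carrier (presented_monoid ?A ?R).
        Y \<otimes>\<^bsub>presented_monoid ?A ?R\<^esub> X = \<one>\<^bsub>presented_monoid ?A ?R\<^esub>"
      using w by (intro bexI[of _ "word_class ?A ?R v"])
        (simp_all add: presented_monoid_mult presented_monoid_one word_class_eq_iff)
  qed (simp_all add: m_assoc)
qed


section \<open>The group algebra\<close>

text \<open>Elements of \<open>K[G]\<close> are the finitely supported functions from \<open>G\<close> to \<open>K\<close>, extended by
  \<open>undefined\<close> outside the carrier of \<open>G\<close>; the product is convolution.\<close>

definition group_algebra ::
  "('k, 'm) ring_scheme \<Rightarrow> ('g, 'l) monoid_scheme \<Rightarrow> ('k, 'g \<Rightarrow> 'k) module" where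
  "group_algebra K G =
    \<lparr>carrier = {f \<in> carrier G \<rightarrow>\<^sub>E carrier K. finite {x \<in> carrier G. f x \<noteq> \<zero>\<^bsub>K\<^esub>}},
     mult = (\<lambda>f h. \<lambda>g\<in>carrier G.
       \<Oplus>\<^bsub>K\<^esub>x\<in>{x \<in> carrier G. f x \<noteq> \<zero>\<^bsub>K\<^esub>}. f x \<otimes>\<^bsub>K\<^esub> h (inv\<^bsub>G\<^esub> x \<otimes>\<^bsub>G\<^esub> g)),
     one = (\<lambda>g\<in>carrier G. if g = \<one>\<^bsub>G\<^esub> then \<one>\<^bsub>K\<^esub> else \<zero>\<^bsub>K\<^esub>),
     zero = (\<lambda>g\<in>carrier G. \<zero>\<^bsub>K\<^esub>),
     add = (\<lambda>f h. \<lambda>g\<in>carrier G. f g \<oplus>\<^bsub>K\<^esub> h g),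
     smult = (\<lambda>a f. \<lambda>g\<in>carrier G. a \<otimes>\<^bsub>K\<^esub> f g)\<rparr>"

text \<open>The canonical embedding of \<open>G\<close> into \<open>K[G]\<close>.\<close>

definition group_elem ::
  "('k, 'm) ring_scheme \<Rightarrow> ('g, 'l) monoid_scheme \<Rightarrow> 'g \<Rightarrow> 'g \<Rightarrow> 'k" where
  "group_elem K G x = (\<lambda>g\<in>carrier G. if g = x then \<one>\<^bsub>K\<^esub> else \<zero>\<^bsub>K\<^esub>)"


locale group_ring = G: group G + ring K
  for G :: "('g, 'l) monoid_scheme" and K :: "('k, 'm) ring_scheme" (structure)
begin

abbreviation KG where "KG \<equiv> group_algebra K G"
abbreviation supp where "supp f \<equiv> {x \<in> carrier G. f x \<noteq> \<zero>}"

lemma carrierI: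
  "\<lbrakk>f \<in> carrier G \<rightarrow>\<^sub>E carrier K; finite (supp f)\<rbrakk> \<Longrightarrow> f \<in> carrier KG"
  by (simp add: group_algebra_def)

lemma carrierD:
  assumes "f \<in> carrier KG"
  shows "f \<in> carrier G \<rightarrow>\<^sub>E carrier K" "finite (supp f)" "x \<in> carrier G \<Longrightarrow> f x \<in> carrier K"
  using assms by (auto simp: group_algebra_def)

lemma KG_eqI:
  "\<lbrakk>f \<in> carrier KG; h \<in> carrier KG; \<And>x. x \<in> carrier G \<Longrightarrow> f x = h x\<rbrakk> \<Longrightarrow> f = h"
  by (rule extensionalityI[of _ "carrier G"]) (auto dest!: carrierD(1) simp: PiE_def)

lemma apply_simps [simp]:
  assumes "x \<in> carrier G"
  shows "\<zero>\<^bsub>KG\<^esub> x = \<zero>" "(f \<oplus>\<^bsub>KG\<^esub> h) x = f x \<oplus> h x" "(a \<odot>\<^bsub>KG\<^esub> f) x = a \<otimes> f x"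
    "\<one>\<^bsub>KG\<^esub> x = (if x = \<one>\<^bsub>G\<^esub> then \<one> else \<zero>)"
  using assms by (simp_all add: group_algebra_def)

lemma mult_apply:
  assumes f: "f \<in> carrier KG" and h: "h \<in> carrier KG" and g: "g \<in> carrier G"
    and S: "finite S" "supp f \<subseteq> S" "S \<subseteq> carrier G"
  shows "(f \<otimes>\<^bsub>KG\<^esub> h) g = (\<Oplus>x\<in>S. f x \<otimes> h (inv\<^bsub>G\<^esub> x \<otimes>\<^bsub>G\<^esub> g))"
proof -
  have "(f \<otimes>\<^bsub>KG\<^esub> h) g = (\<Oplus>x\<in>supp f. f x \<otimes> h (inv\<^bsub>G\<^esub> x \<otimes>\<^bsub>G\<^esub> g))"
    using g by (simp add: group_algebra_def)
  also have "\<dots> = (\<Oplus>x\<in>S. f x \<otimes> h (inv\<^bsub>G\<^esub> x \<otimes>\<^bsub>G\<^esub> g))"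
    using S g carrierD(3)[OF f] carrierD(3)[OF h]
    by (intro add.finprod_mono_neutral_cong_left) (auto simp: subset_iff)
  finally show ?thesis .
qed

lemma zero_closed_KG: "\<zero>\<^bsub>KG\<^esub> \<in> carrier KG"
  by (simp add: group_algebra_def)

lemma one_closed_KG: "\<one>\<^bsub>KG\<^esub> \<in> carrier KG"
  by (simp add: group_algebra_def)

lemma group_elem_closed: "group_elem K G x \<in> carrier KG"
  by (auto simp: group_algebra_def group_elem_def)

lemma add_closed_KG:
  assumes "f \<in> carrier KG" "h \<in> carrier KG"
  shows "f \<oplus>\<^bsub>KG\<^esub> h \<in> carrier KG"
proof (rule carrierI)
  show "f \<oplus>\<^bsub>KG\<^esub> h \<in> carrier G \<rightarrow>\<^sub>E carrier K"
    using carrierD(3)[OF assms(1)] carrierD(3)[OF assms(2)] by (simp add: group_algebra_def)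
  show "finite (supp (f \<oplus>\<^bsub>KG\<^esub> h))"
    by (rule finite_subset[of _ "supp f \<union> supp h"])
      (use carrierD(2)[OF assms(1)] carrierD(2)[OF assms(2)] in auto)
qed

lemma smult_closed_KG:
  assumes "a \<in> carrier K" "f \<in> carrier KG"
  shows "a \<odot>\<^bsub>KG\<^esub> f \<in> carrier KG"
proof (rule carrierI)
  show "a \<odot>\<^bsub>KG\<^esub> f \<in> carrier G \<rightarrow>\<^sub>E carrier K"
    using assms(1) carrierD(3)[OF assms(2)] by (simp add: group_algebra_def)
  show "finite (supp (a \<odot>\<^bsub>KG\<^esub> f))"
    by (rule finite_subset[of _ "supp f"]) (use assms(1) carrierD(2)[OF assms(2)] in auto)
qed

lemma supp_mult:
  assumes "f \<in> carrier KG" "h \<in> carrier KG"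
  shows "supp (f \<otimes>\<^bsub>KG\<^esub> h) \<subseteq> (\<lambda>(x, y). x \<otimes>\<^bsub>G\<^esub> y) ` (supp f \<times> supp h)"
proof
  fix g assume g: "g \<in> supp (f \<otimes>\<^bsub>KG\<^esub> h)"
  have "\<exists>x\<in>supp f. h (inv\<^bsub>G\<^esub> x \<otimes>\<^bsub>G\<^esub> g) \<noteq> \<zero>"
  proof (rule ccontr)
    assume "\<not> ?thesis"
    then have "(\<Oplus>x\<in>supp f. f x \<otimes> h (inv\<^bsub>G\<^esub> x \<otimes>\<^bsub>G\<^esub> g)) = (\<Oplus>x\<in>supp f. \<zero>)"
      using carrierD(3)[OF assms(1)] by (intro finsum_cong') auto
    then show False
      using g mult_apply[OF assms, of g "supp f"] carrierD(2)[OF assms(1)] by simp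
  qed
  then obtain x where x: "x \<in> supp f" "h (inv\<^bsub>G\<^esub> x \<otimes>\<^bsub>G\<^esub> g) \<noteq> \<zero>" by blast
  with g have "g = x \<otimes>\<^bsub>G\<^esub> (inv\<^bsub>G\<^esub> x \<otimes>\<^bsub>G\<^esub> g)"
    by (simp add: G.m_assoc[symmetric])
  moreover have "inv\<^bsub>G\<^esub> x \<otimes>\<^bsub>G\<^esub> g \<in> supp h" using x g by simp
  ultimately show "g \<in> (\<lambda>(x, y). x \<otimes>\<^bsub>G\<^esub> y) ` (supp f \<times> supp h)"
    using x(1) by (intro image_eqI[of _ _ "(x, inv\<^bsub>G\<^esub> x \<otimes>\<^bsub>G\<^esub> g)"]) auto
qed

lemma mult_closed_KG:
  assumes "f \<in> carrier KG" "h \<in> carrier KG"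
  shows "f \<otimes>\<^bsub>KG\<^esub> h \<in> carrier KG"
proof (rule carrierI)
  show "f \<otimes>\<^bsub>KG\<^esub> h \<in> carrier G \<rightarrow>\<^sub>E carrier K"
    using carrierD(3)[OF assms(1)] carrierD(3)[OF assms(2)]
    by (auto simp: group_algebra_def intro!: finsum_closed)
  show "finite (supp (f \<otimes>\<^bsub>KG\<^esub> h))"
    by (rule finite_subset[OF supp_mult[OF assms]])
      (use carrierD(2)[OF assms(1)] carrierD(2)[OF assms(2)] in blast)
qed

lemma finsum_exchange:
  assumes "finite A" "finite B" "\<And>x y. \<lbrakk>x \<in> A; y \<in> B\<rbrakk> \<Longrightarrow> F x y \<in> carrier K"
  shows "(\<Oplus>x\<in>A. \<Oplus>y\<in>B. F x y) = (\<Oplus>y\<in>B. \<Oplus>x\<in>A. F x y)"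
  using assms(1,3)
proof (induction A)
  case empty
  then show ?case by simp
next
  case (insert a A)
  have "(\<Oplus>y\<in>B. \<Oplus>x\<in>insert a A. F x y) = (\<Oplus>y\<in>B. F a y \<oplus> (\<Oplus>x\<in>A. F x y))"
    using insert.prems insert.hyps by (intro finsum_cong') (auto simp: finsum_insert Pi_def)
  also have "\<dots> = (\<Oplus>y\<in>B. F a y) \<oplus> (\<Oplus>y\<in>B. \<Oplus>x\<in>A. F x y)"
    using insert.prems by (intro finsum_addf) (auto intro!: finsum_closed)
  also have "(\<Oplus>y\<in>B. \<Oplus>x\<in>A. F x y) = (\<Oplus>x\<in>A. \<Oplus>y\<in>B. F x y)"
    using insert by auto
  finally show ?case
    using insert.prems insert.hyps by (simp add: finsum_insert Pi_def)
qed

lemma mult_assoc_KG: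
  assumes f: "f \<in> carrier KG" and h: "h \<in> carrier KG" and k: "k \<in> carrier KG"
  shows "(f \<otimes>\<^bsub>KG\<^esub> h) \<otimes>\<^bsub>KG\<^esub> k = f \<otimes>\<^bsub>KG\<^esub> (h \<otimes>\<^bsub>KG\<^esub> k)"
proof (rule KG_eqI)
  fix g assume g: "g \<in> carrier G"
  define S where "S = (\<lambda>(x, y). x \<otimes>\<^bsub>G\<^esub> y) ` (supp f \<times> supp h)"
  have S: "finite S" "S \<subseteq> carrier G" "supp (f \<otimes>\<^bsub>KG\<^esub> h) \<subseteq> S"
    using carrierD(2)[OF f] carrierD(2)[OF h] supp_mult[OF f h] by (auto simp: S_def)
  note [simp] = carrierD(3)[OF f] carrierD(3)[OF h] carrierD(3)[OF k]
  have SG [simp]: "x \<in> carrier G" if "x \<in> S" for x using S(2) that by blast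
  have inner: "(\<Oplus>x\<in>S. h (inv\<^bsub>G\<^esub> y \<otimes>\<^bsub>G\<^esub> x) \<otimes> k (inv\<^bsub>G\<^esub> x \<otimes>\<^bsub>G\<^esub> g)) = (h \<otimes>\<^bsub>KG\<^esub> k) (inv\<^bsub>G\<^esub> y \<otimes>\<^bsub>G\<^esub> g)"
    if y: "y \<in> supp f" for y
  proof -
    let ?T = "(\<lambda>x. inv\<^bsub>G\<^esub> y \<otimes>\<^bsub>G\<^esub> x) ` S"
    have yG [simp]: "y \<in> carrier G" using y by simp
    have T: "supp h \<subseteq> ?T"
    proof
      fix z assume z: "z \<in> supp h"
      then have "z = inv\<^bsub>G\<^esub> y \<otimes>\<^bsub>G\<^esub> (y \<otimes>\<^bsub>G\<^esub> z)" by (simp add: G.m_assoc[symmetric])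
      moreover have "y \<otimes>\<^bsub>G\<^esub> z \<in> S" using y z unfolding S_def by blast
      ultimately show "z \<in> ?T" by blast
    qed
    have TG: "?T \<subseteq> carrier G" using S(2) y by auto
    have "(h \<otimes>\<^bsub>KG\<^esub> k) (inv\<^bsub>G\<^esub> y \<otimes>\<^bsub>G\<^esub> g)
        = (\<Oplus>z\<in>?T. h z \<otimes> k (inv\<^bsub>G\<^esub> z \<otimes>\<^bsub>G\<^esub> (inv\<^bsub>G\<^esub> y \<otimes>\<^bsub>G\<^esub> g)))"
      using S(1) T TG y g by (intro mult_apply[OF h k]) auto
    also have "\<dots> = (\<Oplus>x\<in>S. h (inv\<^bsub>G\<^esub> y \<otimes>\<^bsub>G\<^esub> x) \<otimes> k (inv\<^bsub>G\<^esub> (inv\<^bsub>G\<^esub> y \<otimes>\<^bsub>G\<^esub> x) \<otimes>\<^bsub>G\<^esub> (inv\<^bsub>G\<^esub> y \<otimes>\<^bsub>G\<^esub> g)))"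
      using y g by (intro finsum_reindex) (auto simp: inj_on_def)
    also have "\<dots> = (\<Oplus>x\<in>S. h (inv\<^bsub>G\<^esub> y \<otimes>\<^bsub>G\<^esub> x) \<otimes> k (inv\<^bsub>G\<^esub> x \<otimes>\<^bsub>G\<^esub> g))"
    proof (rule finsum_cong')
      fix x assume x: "x \<in> S"
      have "inv\<^bsub>G\<^esub> (inv\<^bsub>G\<^esub> y \<otimes>\<^bsub>G\<^esub> x) \<otimes>\<^bsub>G\<^esub> (inv\<^bsub>G\<^esub> y \<otimes>\<^bsub>G\<^esub> g) = inv\<^bsub>G\<^esub> x \<otimes>\<^bsub>G\<^esub> (y \<otimes>\<^bsub>G\<^esub> (inv\<^bsub>G\<^esub> y \<otimes>\<^bsub>G\<^esub> g))"
        using x y g by (simp add: G.inv_mult_group G.m_assoc)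
      also have "\<dots> = inv\<^bsub>G\<^esub> x \<otimes>\<^bsub>G\<^esub> g"
        using y g by (simp add: G.m_assoc[symmetric])
      finally show "h (inv\<^bsub>G\<^esub> y \<otimes>\<^bsub>G\<^esub> x) \<otimes> k (inv\<^bsub>G\<^esub> (inv\<^bsub>G\<^esub> y \<otimes>\<^bsub>G\<^esub> x) \<otimes>\<^bsub>G\<^esub> (inv\<^bsub>G\<^esub> y \<otimes>\<^bsub>G\<^esub> g))
          = h (inv\<^bsub>G\<^esub> y \<otimes>\<^bsub>G\<^esub> x) \<otimes> k (inv\<^bsub>G\<^esub> x \<otimes>\<^bsub>G\<^esub> g)" by simp
    qed (use g in auto)
    finally show ?thesis by simp
  qed
  have "((f \<otimes>\<^bsub>KG\<^esub> h) \<otimes>\<^bsub>KG\<^esub> k) g = (\<Oplus>x\<in>S. (f \<otimes>\<^bsub>KG\<^esub> h) x \<otimes> k (inv\<^bsub>G\<^esub> x \<otimes>\<^bsub>G\<^esub> g))"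
    using S g by (intro mult_apply[OF mult_closed_KG[OF f h] k]) auto
  also have "\<dots> = (\<Oplus>x\<in>S. \<Oplus>y\<in>supp f. f y \<otimes> (h (inv\<^bsub>G\<^esub> y \<otimes>\<^bsub>G\<^esub> x) \<otimes> k (inv\<^bsub>G\<^esub> x \<otimes>\<^bsub>G\<^esub> g)))"
  proof (rule finsum_cong')
    fix x assume x: "x \<in> S"
    have "(f \<otimes>\<^bsub>KG\<^esub> h) x \<otimes> k (inv\<^bsub>G\<^esub> x \<otimes>\<^bsub>G\<^esub> g)
        = (\<Oplus>y\<in>supp f. f y \<otimes> h (inv\<^bsub>G\<^esub> y \<otimes>\<^bsub>G\<^esub> x)) \<otimes> k (inv\<^bsub>G\<^esub> x \<otimes>\<^bsub>G\<^esub> g)"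
      using x carrierD(2)[OF f] by (subst mult_apply[OF f h, of x "supp f"]) auto
    also have "\<dots> = (\<Oplus>y\<in>supp f. f y \<otimes> h (inv\<^bsub>G\<^esub> y \<otimes>\<^bsub>G\<^esub> x) \<otimes> k (inv\<^bsub>G\<^esub> x \<otimes>\<^bsub>G\<^esub> g))"
      using x g carrierD(2)[OF f] by (intro finsum_ldistr) auto
    also have "\<dots> = (\<Oplus>y\<in>supp f. f y \<otimes> (h (inv\<^bsub>G\<^esub> y \<otimes>\<^bsub>G\<^esub> x) \<otimes> k (inv\<^bsub>G\<^esub> x \<otimes>\<^bsub>G\<^esub> g)))"
      using x g by (intro finsum_cong') (auto simp: m_assoc)
    finally show "(f \<otimes>\<^bsub>KG\<^esub> h) x \<otimes> k (inv\<^bsub>G\<^esub> x \<otimes>\<^bsub>G\<^esub> g)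
        = (\<Oplus>y\<in>supp f. f y \<otimes> (h (inv\<^bsub>G\<^esub> y \<otimes>\<^bsub>G\<^esub> x) \<otimes> k (inv\<^bsub>G\<^esub> x \<otimes>\<^bsub>G\<^esub> g)))" .
  qed (use g in \<open>auto intro!: finsum_closed\<close>)
  also have "\<dots> = (\<Oplus>y\<in>supp f. \<Oplus>x\<in>S. f y \<otimes> (h (inv\<^bsub>G\<^esub> y \<otimes>\<^bsub>G\<^esub> x) \<otimes> k (inv\<^bsub>G\<^esub> x \<otimes>\<^bsub>G\<^esub> g)))"
    using S g carrierD(2)[OF f] by (intro finsum_exchange) auto
  also have "\<dots> = (\<Oplus>y\<in>supp f. f y \<otimes> (h \<otimes>\<^bsub>KG\<^esub> k) (inv\<^bsub>G\<^esub> y \<otimes>\<^bsub>G\<^esub> g))"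
  proof (rule finsum_cong')
    fix y assume y: "y \<in> supp f"
    have "(\<Oplus>x\<in>S. f y \<otimes> (h (inv\<^bsub>G\<^esub> y \<otimes>\<^bsub>G\<^esub> x) \<otimes> k (inv\<^bsub>G\<^esub> x \<otimes>\<^bsub>G\<^esub> g)))
        = f y \<otimes> (\<Oplus>x\<in>S. h (inv\<^bsub>G\<^esub> y \<otimes>\<^bsub>G\<^esub> x) \<otimes> k (inv\<^bsub>G\<^esub> x \<otimes>\<^bsub>G\<^esub> g))"
      using S y g by (intro finsum_rdistr[symmetric]) auto
    then show "(\<Oplus>x\<in>S. f y \<otimes> (h (inv\<^bsub>G\<^esub> y \<otimes>\<^bsub>G\<^esub> x) \<otimes> k (inv\<^bsub>G\<^esub> x \<otimes>\<^bsub>G\<^esub> g)))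
        = f y \<otimes> (h \<otimes>\<^bsub>KG\<^esub> k) (inv\<^bsub>G\<^esub> y \<otimes>\<^bsub>G\<^esub> g)"
      by (simp add: inner[OF y])
  qed (use g carrierD(3)[OF mult_closed_KG[OF h k]] in auto)
  also have "\<dots> = (f \<otimes>\<^bsub>KG\<^esub> (h \<otimes>\<^bsub>KG\<^esub> k)) g"
    using g carrierD(2)[OF f] by (intro mult_apply[OF f mult_closed_KG[OF h k], symmetric]) auto
  finally show "((f \<otimes>\<^bsub>KG\<^esub> h) \<otimes>\<^bsub>KG\<^esub> k) g = (f \<otimes>\<^bsub>KG\<^esub> (h \<otimes>\<^bsub>KG\<^esub> k)) g" .
qed (use f h k in \<open>simp_all add: mult_closed_KG\<close>)

lemma group_elem_mult_apply:
  assumes "x \<in> carrier G" "f \<in> carrier KG" "g \<in> carrier G"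
  shows "(group_elem K G x \<otimes>\<^bsub>KG\<^esub> f) g = f (inv\<^bsub>G\<^esub> x \<otimes>\<^bsub>G\<^esub> g)"
proof -
  have "supp (group_elem K G x) \<subseteq> {x}" by (auto simp: group_elem_def)
  then have "(group_elem K G x \<otimes>\<^bsub>KG\<^esub> f) g = group_elem K G x x \<otimes> f (inv\<^bsub>G\<^esub> x \<otimes>\<^bsub>G\<^esub> g)"
    using mult_apply[OF group_elem_closed[of x] assms(2,3), of "{x}"] assms
      carrierD(3)[OF assms(2)] carrierD(3)[OF group_elem_closed[of x]] by simp
  then show ?thesis
    using assms carrierD(3)[OF assms(2)] by (simp add: group_elem_def)
qed

lemma group_elem_one: "group_elem K G \<one>\<^bsub>G\<^esub> = \<one>\<^bsub>KG\<^esub>"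
  by (simp add: group_elem_def group_algebra_def)

lemma group_elem_mult:
  assumes "x \<in> carrier G" "y \<in> carrier G"
  shows "group_elem K G x \<otimes>\<^bsub>KG\<^esub> group_elem K G y = group_elem K G (x \<otimes>\<^bsub>G\<^esub> y)"
proof (rule KG_eqI)
  fix g assume g: "g \<in> carrier G"
  have "inv\<^bsub>G\<^esub> x \<otimes>\<^bsub>G\<^esub> g = y \<longleftrightarrow> g = x \<otimes>\<^bsub>G\<^esub> y"
    using assms g G.inv_solve_left' by auto
  then show "(group_elem K G x \<otimes>\<^bsub>KG\<^esub> group_elem K G y) g = group_elem K G (x \<otimes>\<^bsub>G\<^esub> y) g"
    using assms g by (simp add: group_elem_mult_apply group_elem_closed) (simp add: group_elem_def)
qed (simp_all add: mult_closed_KG group_elem_closed)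

lemma mult_one_KG:
  assumes f: "f \<in> carrier KG"
  shows "f \<otimes>\<^bsub>KG\<^esub> \<one>\<^bsub>KG\<^esub> = f"
proof (rule KG_eqI)
  fix g assume g: "g \<in> carrier G"
  let ?S = "insert g (supp f)"
  have "(f \<otimes>\<^bsub>KG\<^esub> \<one>\<^bsub>KG\<^esub>) g = (\<Oplus>x\<in>?S. f x \<otimes> \<one>\<^bsub>KG\<^esub> (inv\<^bsub>G\<^esub> x \<otimes>\<^bsub>G\<^esub> g))"
    using g carrierD(2)[OF f] by (intro mult_apply[OF f one_closed_KG]) auto
  also have "\<dots> = (\<Oplus>x\<in>?S. if g = x then f x else \<zero>)"
  proof (rule finsum_cong')
    fix x assume "x \<in> ?S"
    then have x: "x \<in> carrier G" using g by auto
    then have "inv\<^bsub>G\<^esub> x \<otimes>\<^bsub>G\<^esub> g = \<one>\<^bsub>G\<^esub> \<longleftrightarrow> g = x"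
      using g G.inv_solve_left' by auto
    with x g show "f x \<otimes> \<one>\<^bsub>KG\<^esub> (inv\<^bsub>G\<^esub> x \<otimes>\<^bsub>G\<^esub> g) = (if g = x then f x else \<zero>)"
      using carrierD(3)[OF f] by simp
  qed (use g carrierD(3)[OF f] in auto)
  also have "\<dots> = f g"
    using g carrierD(2,3)[OF f] by (intro finsum_singleton) auto
  finally show "(f \<otimes>\<^bsub>KG\<^esub> \<one>\<^bsub>KG\<^esub>) g = f g" .
qed (use f in \<open>simp_all add: mult_closed_KG one_closed_KG\<close>)

lemma ring_group_algebra: "ring KG"
proof (rule ringI)
  show "abelian_group KG"
  proof (rule abelian_groupI)
    fix f assume f: "f \<in> carrier KG"
    have m: "\<ominus> \<one> \<odot>\<^bsub>KG\<^esub> f \<in> carrier KG" using f by (simp add: smult_closed_KG)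
    moreover have "(\<ominus> \<one> \<odot>\<^bsub>KG\<^esub> f) \<oplus>\<^bsub>KG\<^esub> f = \<zero>\<^bsub>KG\<^esub>"
      using f m carrierD(3)[OF f]
      by (intro KG_eqI) (auto simp: add_closed_KG zero_closed_KG l_minus l_neg)
    ultimately show "\<exists>h\<in>carrier KG. h \<oplus>\<^bsub>KG\<^esub> f = \<zero>\<^bsub>KG\<^esub>" by blast
  qed (auto intro!: KG_eqI simp: add_closed_KG zero_closed_KG add.m_ac carrierD(3))
  show "monoid KG"
  proof (rule monoidI)
    fix f assume f: "f \<in> carrier KG"
    then show "\<one>\<^bsub>KG\<^esub> \<otimes>\<^bsub>KG\<^esub> f = f"
      by (intro KG_eqI)
        (auto simp: group_elem_mult_apply mult_closed_KG group_elem_closed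
          simp flip: group_elem_one)
  qed (simp_all add: mult_closed_KG one_closed_KG mult_assoc_KG mult_one_KG)
next
  fix f h k assume f: "f \<in> carrier KG" and h: "h \<in> carrier KG" and k: "k \<in> carrier KG"
  note [simp] = carrierD(3)[OF f] carrierD(3)[OF h] carrierD(3)[OF k]
  show "(f \<oplus>\<^bsub>KG\<^esub> h) \<otimes>\<^bsub>KG\<^esub> k = f \<otimes>\<^bsub>KG\<^esub> k \<oplus>\<^bsub>KG\<^esub> h \<otimes>\<^bsub>KG\<^esub> k"
  proof (rule KG_eqI)
    fix g assume g: "g \<in> carrier G"
    let ?S = "supp f \<union> supp h"
    have S: "finite ?S" "?S \<subseteq> carrier G" using carrierD(2)[OF f] carrierD(2)[OF h] by auto
    have "((f \<oplus>\<^bsub>KG\<^esub> h) \<otimes>\<^bsub>KG\<^esub> k) g = (\<Oplus>x\<in>?S. (f \<oplus>\<^bsub>KG\<^esub> h) x \<otimes> k (inv\<^bsub>G\<^esub> x \<otimes>\<^bsub>G\<^esub> g))"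
      using S g by (intro mult_apply[OF add_closed_KG[OF f h] k]) auto
    also have "\<dots> = (\<Oplus>x\<in>?S. f x \<otimes> k (inv\<^bsub>G\<^esub> x \<otimes>\<^bsub>G\<^esub> g) \<oplus> h x \<otimes> k (inv\<^bsub>G\<^esub> x \<otimes>\<^bsub>G\<^esub> g))"
      using g by (intro finsum_cong') (auto simp: l_distr)
    also have "\<dots> = (f \<otimes>\<^bsub>KG\<^esub> k) g \<oplus> (h \<otimes>\<^bsub>KG\<^esub> k) g"
      using S g
      by (subst finsum_addf) (auto simp: mult_apply[OF f k, of g ?S] mult_apply[OF h k, of g ?S])
    finally show "((f \<oplus>\<^bsub>KG\<^esub> h) \<otimes>\<^bsub>KG\<^esub> k) g = (f \<otimes>\<^bsub>KG\<^esub> k \<oplus>\<^bsub>KG\<^esub> h \<otimes>\<^bsub>KG\<^esub> k) g"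
      using g by simp
  qed (use f h k in \<open>simp_all add: add_closed_KG mult_closed_KG\<close>)
  show "k \<otimes>\<^bsub>KG\<^esub> (f \<oplus>\<^bsub>KG\<^esub> h) = k \<otimes>\<^bsub>KG\<^esub> f \<oplus>\<^bsub>KG\<^esub> k \<otimes>\<^bsub>KG\<^esub> h"
  proof (rule KG_eqI)
    fix g assume g: "g \<in> carrier G"
    let ?S = "supp k"
    have S: "finite ?S" "?S \<subseteq> carrier G" using carrierD(2)[OF k] by auto
    have "(k \<otimes>\<^bsub>KG\<^esub> (f \<oplus>\<^bsub>KG\<^esub> h)) g = (\<Oplus>x\<in>?S. k x \<otimes> (f \<oplus>\<^bsub>KG\<^esub> h) (inv\<^bsub>G\<^esub> x \<otimes>\<^bsub>G\<^esub> g))"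
      using S g by (intro mult_apply[OF k add_closed_KG[OF f h]]) auto
    also have "\<dots> = (\<Oplus>x\<in>?S. k x \<otimes> f (inv\<^bsub>G\<^esub> x \<otimes>\<^bsub>G\<^esub> g) \<oplus> k x \<otimes> h (inv\<^bsub>G\<^esub> x \<otimes>\<^bsub>G\<^esub> g))"
      using g by (intro finsum_cong') (auto simp: r_distr)
    also have "\<dots> = (k \<otimes>\<^bsub>KG\<^esub> f) g \<oplus> (k \<otimes>\<^bsub>KG\<^esub> h) g"
      using S g
      by (subst finsum_addf) (auto simp: mult_apply[OF k f, of g ?S] mult_apply[OF k h, of g ?S])
    finally show "(k \<otimes>\<^bsub>KG\<^esub> (f \<oplus>\<^bsub>KG\<^esub> h)) g = (k \<otimes>\<^bsub>KG\<^esub> f \<oplus>\<^bsub>KG\<^esub> k \<otimes>\<^bsub>KG\<^esub> h) g"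
      using g by simp
  qed (use f h k in \<open>simp_all add: add_closed_KG mult_closed_KG\<close>)
qed

end

lemma module_group_algebra:
  assumes "group G" "cring K"
  shows "module K (group_algebra K G)"
proof -
  interpret cring K by fact
  interpret group_ring G K using assms by (simp add: group_ring_def ring_axioms)
  interpret KG: ring KG by (rule ring_group_algebra)
  show ?thesis
    by (rule moduleI[OF assms(2) KG.is_abelian_group])
      (auto intro!: KG_eqI simp: smult_closed_KG l_distr r_distr m_assoc carrierD(3))
qed

end

theory Submission
  imports Defs
begin

text \<open>By the universal property of a presentation it suffices to check the defining relations
  of the singular braid monoid on the images of the generators. The relations without \<open>\<tau>\<close> hold
  because they hold under \<open>\<phi>\<close>. Every other relation has the form \<open>X \<tau>\<^sub>i = \<tau>\<^sub>j X\<close>, and it follows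
  from \<open>X \<sigma>\<^sub>i = \<sigma>\<^sub>j X\<close>: the latter also gives \<open>X \<sigma>\<^sub>i\<^sup>-\<^sup>1 = \<sigma>\<^sub>j\<^sup>-\<^sup>1 X\<close>, and hence \<open>X\<close> intertwines
  \<open>a \<sigma>\<^sub>i + b \<sigma>\<^sub>i\<^sup>-\<^sup>1 + c\<close> with \<open>a \<sigma>\<^sub>j + b \<sigma>\<^sub>j\<^sup>-\<^sup>1 + c\<close>.\<close>

section \<open>The universal property of a presentation\<close>

text \<open>The homomorphism from the free monoid of words that extends \<open>f\<close>. Its
  products nest to the right, which is why the relations checked later are bracketed that
  way.\<close>

definition word_eval :: "('b, 'm) monoid_scheme \<Rightarrow> ('a \<Rightarrow> 'b) \<Rightarrow> 'a list \<Rightarrow> 'b" where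
  "word_eval M f w = foldr (\<lambda>x. mult M (f x)) w \<one>\<^bsub>M\<^esub>"

lemma word_eval_simps [simp]:
  "word_eval M f [] = \<one>\<^bsub>M\<^esub>"
  "word_eval M f (x # w) = f x \<otimes>\<^bsub>M\<^esub> word_eval M f w"
  by (simp_all add: word_eval_def)

lemma word_eval_cong:
  assumes "w \<in> lists A" "\<And>x. x \<in> A \<Longrightarrow> f x = g x"
  shows "word_eval M f w = word_eval M g w"
  using assms by (induction w) auto

context monoid
begin

lemma word_eval_closed:
  assumes "f \<in> A \<rightarrow> carrier G" "w \<in> lists A"
  shows "word_eval G f w \<in> carrier G"
  using assms(2) by (induction w) (use assms(1) in auto)

lemma word_eval_append:
  assumes "f \<in> A \<rightarrow> carrier G" "u \<in> lists A" "v \<in> lists A"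
  shows "word_eval G f (u @ v) = word_eval G f u \<otimes> word_eval G f v"
  using assms(2)
  by (induction u) (use assms(1,3) in \<open>auto simp: word_eval_closed m_assoc Pi_def\<close>)

text \<open>Having equal values is stable under symmetry and transitivity, and multiplicativity
  carries it from a relation into any context \<open>p @ _ @ q\<close>; so only the relations
  themselves need checking.\<close>

lemma word_eval_respects_cong:
  assumes f: "f \<in> A \<rightarrow> carrier G"
    and R: "\<And>u v. \<lbrakk>(u, v) \<in> R; u \<in> lists A; v \<in> lists A\<rbrakk> \<Longrightarrow> word_eval G f u = word_eval G f v"
    and "word_cong A R u v"
  shows "word_eval G f u = word_eval G f v"
  using assms(3)
proof (induction rule: word_cong.induct)
  case (rel u v p q)
  then show ?case
    using R[of u v] by (simp add: word_eval_append[OF f])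
qed simp_all

text \<open>The class of a word is the product of the classes of its letters. Preservation of the
  unit is a separate hypothesis because \<open>hom\<close> demands multiplicativity only.\<close>

lemma hom_presented_monoid_word_eval:
  assumes "\<Psi> \<in> hom (presented_monoid A R) G" "\<Psi> \<one>\<^bsub>presented_monoid A R\<^esub> = \<one>"
    and "w \<in> lists A"
  shows "\<Psi> (word_class A R w) = word_eval G (\<lambda>x. \<Psi> (word_class A R [x])) w"
  using assms(3)
proof (induction w rule: lists.induct)
  case Nil
  then show ?case using assms(2) by (simp add: presented_monoid_one)
next
  case (Cons x w)
  have "\<Psi> (word_class A R (x # w))
      = \<Psi> (word_class A R [x] \<otimes>\<^bsub>presented_monoid A R\<^esub> word_class A R w)"
    using Cons by (simp add: presented_monoid_mult)
  also have "\<dots> = \<Psi> (word_class A R [x]) \<otimes> \<Psi> (word_class A R w)"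
    using Cons by (intro hom_mult[OF assms(1)]) (auto simp: presented_monoid_carrier)
  finally show ?case using Cons by simp
qed

text \<open>Existence holds because evaluation is constant on classes, uniqueness because the
  letters generate. Membership in \<open>extensional\<close> fixes the values off the carrier, which
  the other conditions leave open.\<close>

lemma presented_monoid_ex1_hom:
  assumes f: "f \<in> A \<rightarrow> carrier G"
    and R: "\<And>u v. \<lbrakk>(u, v) \<in> R; u \<in> lists A; v \<in> lists A\<rbrakk> \<Longrightarrow> word_eval G f u = word_eval G f v"
  shows "\<exists>!\<Phi>. \<Phi> \<in> extensional (carrier (presented_monoid A R)) \<and>
    \<Phi> \<in> hom (presented_monoid A R) G \<and> \<Phi> \<one>\<^bsub>presented_monoid A R\<^esub> = \<one> \<and>
    (\<forall>x\<in>A. \<Phi> (word_class A R [x]) = f x)"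
    (is "\<exists>!\<Phi>. ?P \<Phi>")
proof (rule ex_ex1I)
  let ?M = "presented_monoid A R"
  \<comment> \<open>A class goes to the common value of its words: the image of the class under
    evaluation is a singleton, and \<open>the_elem\<close> extracts its element.\<close>
  define \<Phi> where "\<Phi> = (\<lambda>X\<in>carrier ?M. the_elem (word_eval G f ` X))"
  have \<Phi>: "\<Phi> (word_class A R w) = word_eval G f w" if w: "w \<in> lists A" for w
  proof -
    have "word_eval G f ` word_class A R w = {word_eval G f w}"
      using word_eval_respects_cong[OF f R] word_cong.refl[OF w]
      by (fastforce simp: word_class_def)
    with w show ?thesis by (simp add: \<Phi>_def presented_monoid_carrier)
  qed
  have "\<Phi> \<in> hom ?M G"
    by (rule homI; unfold presented_monoid_carrier; elim imageE)
      (simp_all add: presented_monoid_mult \<Phi> word_eval_closed[OF f] word_eval_append[OF f])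
  moreover have "\<Phi> (word_class A R [x]) = f x" if "x \<in> A" for x
    using that f by (simp add: \<Phi> Pi_def)
  moreover have "\<Phi> \<one>\<^bsub>?M\<^esub> = \<one>"
    by (simp add: presented_monoid_one \<Phi>)
  moreover have "\<Phi> \<in> extensional (carrier ?M)"
    by (simp add: \<Phi>_def)
  ultimately have "?P \<Phi>" by blast
  then show "\<exists>\<Phi>. ?P \<Phi>" by (intro exI[of _ \<Phi>])
next
  fix \<Phi> \<Psi> assume \<Phi>: "?P \<Phi>" and \<Psi>: "?P \<Psi>"
  have "\<Phi> (word_class A R w) = \<Psi> (word_class A R w)" if w: "w \<in> lists A" for w
    using \<Phi> \<Psi> hom_presented_monoid_word_eval[OF _ _ w, of \<Phi>]
      hom_presented_monoid_word_eval[OF _ _ w, of \<Psi>] word_eval_cong[OF w]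
    by (metis (no_types, lifting))
  then show "\<Phi> = \<Psi>"
    using \<Phi> \<Psi> by (intro extensionalityI[of _ "carrier (presented_monoid A R)"])
      (auto simp: presented_monoid_carrier)
qed

end


section \<open>Linear combinations of a group element, its inverse and the unit\<close>

context group_ring
begin

lemma smult_mult_KG:
  assumes a: "a \<in> carrier K" and f: "f \<in> carrier KG" and h: "h \<in> carrier KG"
  shows "(a \<odot>\<^bsub>KG\<^esub> f) \<otimes>\<^bsub>KG\<^esub> h = a \<odot>\<^bsub>KG\<^esub> (f \<otimes>\<^bsub>KG\<^esub> h)"
proof (rule KG_eqI)
  fix g assume g: "g \<in> carrier G"
  note [simp] = carrierD(3)[OF f] carrierD(3)[OF h]
  have "((a \<odot>\<^bsub>KG\<^esub> f) \<otimes>\<^bsub>KG\<^esub> h) g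
      = (\<Oplus>x\<in>supp f. (a \<odot>\<^bsub>KG\<^esub> f) x \<otimes> h (inv\<^bsub>G\<^esub> x \<otimes>\<^bsub>G\<^esub> g))"
    using a g carrierD(2)[OF f] by (intro mult_apply[OF smult_closed_KG[OF a f] h]) auto
  also have "\<dots> = (\<Oplus>x\<in>supp f. a \<otimes> (f x \<otimes> h (inv\<^bsub>G\<^esub> x \<otimes>\<^bsub>G\<^esub> g)))"
    using a g by (intro finsum_cong') (auto simp: m_assoc)
  also have "\<dots> = a \<otimes> (f \<otimes>\<^bsub>KG\<^esub> h) g"
    using a g carrierD(2)[OF f]
    by (subst mult_apply[OF f h, of g "supp f"]) (auto intro!: finsum_rdistr[symmetric])
  finally show "((a \<odot>\<^bsub>KG\<^esub> f) \<otimes>\<^bsub>KG\<^esub> h) g = (a \<odot>\<^bsub>KG\<^esub> (f \<otimes>\<^bsub>KG\<^esub> h)) g"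
    using g by simp
qed (use a f h in \<open>simp_all add: mult_closed_KG smult_closed_KG\<close>)

text \<open>Here the scalar must move past the coefficients \<open>f x\<close>, so commutativity of
  \<open>K\<close> enters.\<close>

lemma mult_smult_KG:
  assumes "cring K" and a: "a \<in> carrier K" and f: "f \<in> carrier KG" and h: "h \<in> carrier KG"
  shows "f \<otimes>\<^bsub>KG\<^esub> (a \<odot>\<^bsub>KG\<^esub> h) = a \<odot>\<^bsub>KG\<^esub> (f \<otimes>\<^bsub>KG\<^esub> h)"
proof (rule KG_eqI)
  interpret cring K by fact
  fix g assume g: "g \<in> carrier G"
  note [simp] = carrierD(3)[OF f] carrierD(3)[OF h]
  have "(f \<otimes>\<^bsub>KG\<^esub> (a \<odot>\<^bsub>KG\<^esub> h)) g
      = (\<Oplus>x\<in>supp f. f x \<otimes> (a \<odot>\<^bsub>KG\<^esub> h) (inv\<^bsub>G\<^esub> x \<otimes>\<^bsub>G\<^esub> g))"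
    using g carrierD(2)[OF f] by (intro mult_apply[OF f smult_closed_KG[OF a h]]) auto
  also have "\<dots> = (\<Oplus>x\<in>supp f. a \<otimes> (f x \<otimes> h (inv\<^bsub>G\<^esub> x \<otimes>\<^bsub>G\<^esub> g)))"
    using a g by (intro finsum_cong') (auto simp: m_lcomm)
  also have "\<dots> = a \<otimes> (f \<otimes>\<^bsub>KG\<^esub> h) g"
    using a g carrierD(2)[OF f]
    by (subst mult_apply[OF f h, of g "supp f"]) (auto intro!: finsum_rdistr[symmetric])
  finally show "(f \<otimes>\<^bsub>KG\<^esub> (a \<odot>\<^bsub>KG\<^esub> h)) g = (a \<odot>\<^bsub>KG\<^esub> (f \<otimes>\<^bsub>KG\<^esub> h)) g"
    using g by simp
qed (use a f h in \<open>simp_all add: mult_closed_KG smult_closed_KG\<close>)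

text \<open>Transfers relations from \<open>G\<close> to the group algebra, since the embedding is
  multiplicative and unital.\<close>

lemma word_eval_group_elem:
  assumes "f \<in> A \<rightarrow> carrier G" "w \<in> lists A"
  shows "word_eval KG (\<lambda>x. group_elem K G (f x)) w = group_elem K G (word_eval G f w)"
  using assms(2)
proof (induction w rule: lists.induct)
  case (Cons x w)
  then show ?case
    using assms(1) by (simp add: group_elem_mult G.word_eval_closed[OF assms(1)] Pi_iff)
qed (simp add: group_elem_one)

text \<open>The intended image of \<open>Tau i\<close> when \<open>s\<close> is the image of
  \<open>Sigma i\<close>. Using the inverse in \<open>G\<close> makes it depend on \<open>s\<close>
  alone.\<close>

definition lin_comb :: "'k \<Rightarrow> 'k \<Rightarrow> 'k \<Rightarrow> 'g \<Rightarrow> 'g \<Rightarrow> 'k" where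
  "lin_comb a b c s = a \<odot>\<^bsub>KG\<^esub> group_elem K G s \<oplus>\<^bsub>KG\<^esub> b \<odot>\<^bsub>KG\<^esub> group_elem K G (inv\<^bsub>G\<^esub> s)
    \<oplus>\<^bsub>KG\<^esub> c \<odot>\<^bsub>KG\<^esub> group_elem K G \<one>\<^bsub>G\<^esub>"

lemma lin_comb_closed:
  assumes "a \<in> carrier K" "b \<in> carrier K" "c \<in> carrier K"
  shows "lin_comb a b c s \<in> carrier KG"
  using assms by (simp add: lin_comb_def add_closed_KG smult_closed_KG group_elem_closed)

text \<open>\<open>X\<close> ranges over the whole algebra, not only over group elements, so that it
  can later be the image of some \<open>Tau i\<close>.\<close>

lemma lin_comb_intertwine:
  assumes "cring K" and abc: "a \<in> carrier K" "b \<in> carrier K" "c \<in> carrier K"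
    and st: "s \<in> carrier G" "t \<in> carrier G" and X: "X \<in> carrier KG"
    and eq: "X \<otimes>\<^bsub>KG\<^esub> group_elem K G s = group_elem K G t \<otimes>\<^bsub>KG\<^esub> X"
  shows "X \<otimes>\<^bsub>KG\<^esub> lin_comb a b c s = lin_comb a b c t \<otimes>\<^bsub>KG\<^esub> X"
proof -
  interpret KG: ring KG by (rule ring_group_algebra)
  let ?e = "group_elem K G"
  have inv_mult: "?e (inv\<^bsub>G\<^esub> t) \<otimes>\<^bsub>KG\<^esub> (?e t \<otimes>\<^bsub>KG\<^esub> Y) = Y" if "Y \<in> carrier KG" for Y
    using st that
    by (simp add: mult_assoc_KG[symmetric] group_elem_closed group_elem_mult group_elem_one)
  \<comment> \<open>The unit is inserted on the right as \<open>?e s\<close> times its inverse;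
    \<open>eq\<close> then moves \<open>?e s\<close> across \<open>X\<close>, where it becomes
    \<open>?e t\<close> and cancels.\<close>
  have "?e (inv\<^bsub>G\<^esub> t) \<otimes>\<^bsub>KG\<^esub> X
      = ?e (inv\<^bsub>G\<^esub> t) \<otimes>\<^bsub>KG\<^esub> ((X \<otimes>\<^bsub>KG\<^esub> ?e s) \<otimes>\<^bsub>KG\<^esub> ?e (inv\<^bsub>G\<^esub> s))"
    using st X by (simp add: mult_assoc_KG group_elem_closed group_elem_mult group_elem_one)
  also have "\<dots> = X \<otimes>\<^bsub>KG\<^esub> ?e (inv\<^bsub>G\<^esub> s)"
    using X by (simp add: eq mult_assoc_KG group_elem_closed inv_mult mult_closed_KG)
  finally have "X \<otimes>\<^bsub>KG\<^esub> ?e (inv\<^bsub>G\<^esub> s) = ?e (inv\<^bsub>G\<^esub> t) \<otimes>\<^bsub>KG\<^esub> X" ..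
  with abc X eq show ?thesis
    by (simp add: lin_comb_def KG.l_distr KG.r_distr smult_mult_KG mult_smult_KG[OF assms(1)]
        group_elem_closed add_closed_KG smult_closed_KG group_elem_one)
qed

end


section \<open>The representation of the singular braid monoid\<close>

lemma ball_sbraid_letters:
  "(\<forall>x\<in>sbraid_letters n. P x) \<longleftrightarrow> (\<forall>i\<in>{1..<n}. P (Sigma i) \<and> P (SigmaInv i) \<and> P (Tau i))"
  by (auto simp: sbraid_letters_def braid_letters_def)

lemma braid_class_carrier:
  "w \<in> lists (braid_letters n) \<Longrightarrow> braid_class n w \<in> carrier (braid_group n)"
  by (simp add: braid_group_def presented_monoid_carrier)

lemma braid_rels_in_lists:
  assumes "(u, v) \<in> braid_rels n"
  shows "u \<in> lists (braid_letters n)" "v \<in> lists (braid_letters n)"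
  using assms by (auto simp: braid_rels_def braid_letters_def)

lemma braid_class_rel:
  assumes "(u, v) \<in> braid_rels n"
  shows "braid_class n u = braid_class n v"
  using word_cong.rel[OF assms braid_rels_in_lists[OF assms], of "[]" "[]"]
    word_class_eq_iff[OF braid_rels_in_lists(1)[OF assms]] by simp

text \<open>Between groups a multiplicative map preserves the unit automatically, which supplies the
  extra hypothesis of the general version.\<close>

lemma hom_braid_group_word_eval:
  assumes "group G" "\<phi> \<in> hom (braid_group n) G" "w \<in> lists (braid_letters n)"
  shows "\<phi> (braid_class n w) = word_eval G (\<lambda>x. \<phi> (braid_class n [x])) w"
proof -
  interpret group_hom "braid_group n" G \<phi>
    using assms group_braid_group by (simp add: group_hom_def group_hom_axioms_def)
  show ?thesis
    using H.hom_presented_monoid_word_eval assms hom_one by (simp add: braid_group_def)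
qed

theorem proposition4p1:
  fixes n :: nat
    and G :: "('g, 'l) monoid_scheme"
    and K :: "('k, 'm) ring_scheme"
    and \<phi> :: "letter list set \<Rightarrow> 'g"
    and a b c :: 'k
  assumes "n \<ge> 2"
    and "group G"
    and "\<phi> \<in> hom (braid_group n) G"
    and "field K"
    and "a \<in> carrier K" and "b \<in> carrier K" and "c \<in> carrier K"
  shows "\<exists>!\<Phi>. \<Phi> \<in> extensional (carrier (singular_braid_monoid n)) \<and>
      \<Phi> \<in> hom (singular_braid_monoid n) (group_algebra K G) \<and>
      \<Phi> \<one>\<^bsub>singular_braid_monoid n\<^esub> = \<one>\<^bsub>group_algebra K G\<^esub> \<and>
      (\<forall>i\<in>{1..<n}.
        \<Phi> (sbraid_class n [Sigma i]) = group_elem K G (\<phi> (braid_class n [Sigma i])) \<and>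
        \<Phi> (sbraid_class n [SigmaInv i]) = group_elem K G (\<phi> (braid_class n [SigmaInv i])) \<and>
        \<Phi> (sbraid_class n [Tau i]) =
          a \<odot>\<^bsub>group_algebra K G\<^esub> group_elem K G (\<phi> (braid_class n [Sigma i]))
          \<oplus>\<^bsub>group_algebra K G\<^esub>
          b \<odot>\<^bsub>group_algebra K G\<^esub> group_elem K G (\<phi> (braid_class n [SigmaInv i]))
          \<oplus>\<^bsub>group_algebra K G\<^esub>
          c \<odot>\<^bsub>group_algebra K G\<^esub> group_elem K G \<one>\<^bsub>G\<^esub>)"
proof -
  interpret G: group G by fact
  interpret K: field K by fact
  interpret group_ring G K
    by (simp add: group_ring_def G.group_axioms K.ring_axioms)
  interpret KG: ring KG by (rule ring_group_algebra)
  let ?e = "group_elem K G" and ?A = "braid_letters n"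
  define \<psi> where "\<psi> x = \<phi> (braid_class n [x])" for x
  define s where "s i = \<psi> (Sigma i)" for i
  define f where "f = case_letter (\<lambda>i. ?e (\<psi> (Sigma i))) (\<lambda>i. ?e (\<psi> (SigmaInv i)))
    (\<lambda>i. lin_comb a b c (s i))"

  \<comment> \<open>Braid relations for the images in \<open>G\<close>\<close>
  have \<psi>: "\<psi> \<in> ?A \<rightarrow> carrier G"
    using hom_carrier[OF assms(3)] braid_class_carrier[of "[_]" n] by (auto simp: \<psi>_def)
  have \<psi>_rel: "word_eval G \<psi> u = word_eval G \<psi> v" if "(u, v) \<in> braid_rels n" for u v
    using hom_braid_group_word_eval[OF assms(2,3)] braid_rels_in_lists[OF that]
      braid_class_rel[OF that] unfolding \<psi>_def by metis
  have s [simp]: "s i \<in> carrier G" if "1 \<le> i" "i < n" for i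
    using \<psi> that by (auto simp: s_def braid_letters_def)
  have \<psi>_inv: "\<psi> (SigmaInv i) = inv\<^bsub>G\<^esub> s i" if "i \<in> {1..<n}" for i
  proof -
    have "\<psi> (SigmaInv i) \<in> carrier G"
      using \<psi> that by (auto simp: braid_letters_def)
    moreover have "s i \<in> carrier G" using that by simp
    moreover have "word_eval G \<psi> [SigmaInv i, Sigma i] = word_eval G \<psi> []"
      using that by (intro \<psi>_rel) (auto simp: braid_rels_def)
    \<comment> \<open>The chosen relation makes \<open>\<psi> (SigmaInv i)\<close> a left inverse of
      \<open>s i\<close>, which suffices in a group.\<close>
    ultimately show ?thesis
      by (simp add: s_def G.inv_equality)
  qed
  \<comment> \<open>The \<open>Suc\<close> forms match what simplification makes of
    \<open>i + 1\<close> and \<open>i + 2\<close> in \<open>sbraid_rels\<close>, so this can serve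
    as a rewrite rule there.\<close>
  have braid: "s i \<otimes>\<^bsub>G\<^esub> (s (Suc i) \<otimes>\<^bsub>G\<^esub> s i) = s (Suc i) \<otimes>\<^bsub>G\<^esub> (s i \<otimes>\<^bsub>G\<^esub> s (Suc i))"
    if "Suc 0 \<le> i" "Suc (Suc i) \<le> n" for i
  proof -
    have "word_eval G \<psi> [Sigma i, Sigma (i + 1), Sigma i]
        = word_eval G \<psi> [Sigma (i + 1), Sigma i, Sigma (i + 1)]"
      using that by (intro \<psi>_rel) (auto simp: braid_rels_def)
    then show ?thesis
      using s[of i] s[of "i + 1"] that by (simp add: s_def)
  qed
  have comm: "s i \<otimes>\<^bsub>G\<^esub> s j = s j \<otimes>\<^bsub>G\<^esub> s i"
    if "i \<in> {1..<n}" "j \<in> {1..<n}" "\<bar>int i - int j\<bar> \<ge> 2" for i j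
  proof -
    have "word_eval G \<psi> [Sigma i, Sigma j] = word_eval G \<psi> [Sigma j, Sigma i]"
      using that by (intro \<psi>_rel) (auto simp: braid_rels_def)
    then show ?thesis
      using s[of i] s[of j] that by (simp add: s_def)
  qed

  \<comment> \<open>Relations involving the singular generators\<close>
  note closed [simp] = group_elem_closed mult_closed_KG lin_comb_closed[OF assms(5-7)]
  have twine: "X \<otimes>\<^bsub>KG\<^esub> lin_comb a b c (s i) = lin_comb a b c (s j) \<otimes>\<^bsub>KG\<^esub> X"
    if "X \<in> carrier KG" "X \<otimes>\<^bsub>KG\<^esub> ?e (s i) = ?e (s j) \<otimes>\<^bsub>KG\<^esub> X" "i \<in> {1..<n}" "j \<in> {1..<n}"
    for X i j
    using that by (intro lin_comb_intertwine[OF K.is_cring assms(5-7)]) auto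
  have twine_elem: "?e g \<otimes>\<^bsub>KG\<^esub> lin_comb a b c (s i) = lin_comb a b c (s j) \<otimes>\<^bsub>KG\<^esub> ?e g"
    if "g \<in> carrier G" "g \<otimes>\<^bsub>G\<^esub> s i = s j \<otimes>\<^bsub>G\<^esub> g" "i \<in> {1..<n}" "j \<in> {1..<n}" for g i j
    using that by (intro twine) (auto simp: group_elem_mult)
  have tau_sigma: "lin_comb a b c (s i) \<otimes>\<^bsub>KG\<^esub> ?e (s j) = ?e (s j) \<otimes>\<^bsub>KG\<^esub> lin_comb a b c (s i)"
    if "i \<in> {1..<n}" "j \<in> {1..<n}" "\<bar>int i - int j\<bar> \<ge> 2 \<or> i = j" for i j
    using that comm[of i j] by (intro twine_elem[symmetric]) auto
  have tau_tau: "lin_comb a b c (s i) \<otimes>\<^bsub>KG\<^esub> lin_comb a b c (s j)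
      = lin_comb a b c (s j) \<otimes>\<^bsub>KG\<^esub> lin_comb a b c (s i)"
    if "i \<in> {1..<n}" "j \<in> {1..<n}" "\<bar>int i - int j\<bar> \<ge> 2" for i j
    \<comment> \<open>The intertwiner is the image of \<open>Tau i\<close> itself;
      \<open>tau_sigma\<close> says that it commutes with \<open>?e (s j)\<close>.\<close>
    using that tau_sigma[of i j] by (intro twine) auto
  \<comment> \<open>The intertwiner is the product of \<open>s i\<close> and \<open>s j\<close>, and
    the braid identity is its intertwining condition. With that identity as a premise, both orders
    of two neighbouring indices are covered.\<close>
  have conj: "?e (s i) \<otimes>\<^bsub>KG\<^esub> (?e (s j) \<otimes>\<^bsub>KG\<^esub> lin_comb a b c (s i))
      = lin_comb a b c (s j) \<otimes>\<^bsub>KG\<^esub> (?e (s i) \<otimes>\<^bsub>KG\<^esub> ?e (s j))"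
    if "s i \<otimes>\<^bsub>G\<^esub> (s j \<otimes>\<^bsub>G\<^esub> s i) = s j \<otimes>\<^bsub>G\<^esub> (s i \<otimes>\<^bsub>G\<^esub> s j)" "i \<in> {1..<n}" "j \<in> {1..<n}" for i j
    using that twine_elem[of "s i \<otimes>\<^bsub>G\<^esub> s j" i j]
    by (simp add: mult_assoc_KG[symmetric] group_elem_mult G.m_assoc)
  have f_simps [simp]: "f (Sigma i) = ?e (s i)" "f (Tau i) = lin_comb a b c (s i)" for i
    by (simp_all add: f_def s_def)
  \<comment> \<open>No index bounds are needed: \<open>group_elem\<close> lands in the algebra for
    every argument.\<close>
  have f: "f \<in> sbraid_letters n \<rightarrow> carrier KG"
    by (auto simp: f_def split: letter.split)
  have f_rel: "word_eval KG f u = word_eval KG f v" if "(u, v) \<in> sbraid_rels n" for u v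
  proof (cases "(u, v) \<in> braid_rels n")
    case True
    \<comment> \<open>On braid letters \<open>f\<close> is the embedding after
      \<open>\<psi>\<close>, so these relations are inherited from \<open>G\<close>.\<close>
    have "f x = ?e (\<psi> x)" if "x \<in> ?A" for x
      using that by (auto simp: f_def braid_letters_def)
    then have "word_eval KG f w = ?e (word_eval G \<psi> w)" if w: "w \<in> lists ?A" for w
      using word_eval_cong[OF w] word_eval_group_elem[OF \<psi> w] by metis
    then show ?thesis
      using \<psi>_rel[OF True] braid_rels_in_lists[OF True] by simp
  next
    case False
    with that show ?thesis
      unfolding sbraid_rels_def
      \<comment> \<open>The reversed \<open>braid\<close> swaps the roles of \<open>i\<close> and
        \<open>i + 1\<close> and settles the last family of relations.\<close>
      by (auto simp: tau_tau tau_sigma braid conj conj[OF braid[symmetric]])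
  qed
  \<comment> \<open>The statement uses the image of \<open>SigmaInv i\<close> where
    \<open>lin_comb\<close> uses an inverse in \<open>G\<close>; \<open>\<psi>_inv\<close>
    identifies them.\<close>
  have *: "?e (\<psi> (Sigma i)) = f (Sigma i)" "?e (\<psi> (SigmaInv i)) = f (SigmaInv i)"
    "a \<odot>\<^bsub>KG\<^esub> ?e (\<psi> (Sigma i)) \<oplus>\<^bsub>KG\<^esub> b \<odot>\<^bsub>KG\<^esub> ?e (\<psi> (SigmaInv i)) \<oplus>\<^bsub>KG\<^esub> c \<odot>\<^bsub>KG\<^esub> ?e \<one>\<^bsub>G\<^esub>
      = f (Tau i)"
    if "i \<in> {1..<n}" for i
    using that by (simp_all add: f_def lin_comb_def \<psi>_inv s_def)
  have generators: "(\<forall>i\<in>{1..<n}. \<Phi> (sbraid_class n [Sigma i]) = ?e (\<psi> (Sigma i)) \<and>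
        \<Phi> (sbraid_class n [SigmaInv i]) = ?e (\<psi> (SigmaInv i)) \<and>
        \<Phi> (sbraid_class n [Tau i]) = a \<odot>\<^bsub>KG\<^esub> ?e (\<psi> (Sigma i)) \<oplus>\<^bsub>KG\<^esub> b \<odot>\<^bsub>KG\<^esub> ?e (\<psi> (SigmaInv i))
          \<oplus>\<^bsub>KG\<^esub> c \<odot>\<^bsub>KG\<^esub> ?e \<one>\<^bsub>G\<^esub>)
      \<longleftrightarrow> (\<forall>x\<in>sbraid_letters n. \<Phi> (sbraid_class n [x]) = f x)" for \<Phi> :: "letter list set \<Rightarrow> 'g \<Rightarrow> 'k"
    using * by (simp add: ball_sbraid_letters del: f_simps)
  show ?thesis
    using KG.presented_monoid_ex1_hom[OF f f_rel]
    unfolding singular_braid_monoid_def \<psi>_def[symmetric] generators by simp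
qed

end
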